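(* Let $X$ be a compact Hausdorff space with compatible uniform structure $\mathscr{U}_X$, let $T$ be a discrete amenable group, and let $(T,X)$ be any w.l.a.p. flow. Then $$\inf_{x\in X}\mathrm{BD}_*(T,x,\varepsilon)>0\quad\text{for all }\varepsilon\in\mathscr{U}_X .$$
   Context: A flow $(T,X)$ with discrete phase group $T$ (identity $e$) is an action $(t,x)\mapsto tx$ of $T\times X$ to $X$, jointly continuous, with $ex=x$ and $t(sx)=(ts)x$. $\mathscr{K}_T$ is the collection of non-empty compact (here: finite) subsets of $T$, and $\mathfrak{N}_x$ is the filter of neighborhoods of $x$ in $X$. $A\subseteq T$ is syndetic if there is $K\in\mathscr{K}_T$ with $Kt\cap A\neq\emptyset$ for all $t\in T$. A point $x\in X$ is weakly locally almost periodic (w.l.a.p.) for $(T,X)$ if given $U\in\mathfrak{N}_x$ there exist $V\in\mathfrak{N}_x$, a syndetic subset $A$ of $T$ and $K\in\mathscr{K}_T$ such that for all $x'\in V$ there is a subset $B$ of $T$ with $Kt\cap B\neq\emptyset$ for all $t\in A$ and $Bx'\subseteq U$. $(T,X)$ is w.l.a.p. if every point of $X$ is a w.l.a.p. point. A discrete group $T$ with counting measure $|\cdot|$ is amenable if it satisfies the left Følner condition: given $K\in\mathscr{K}_T$ and $\varepsilon>0$ there exists $F\in\mathscr{K}_T$ with $|KF\vartriangle F|<\varepsilon|F|$, where $\vartriangle$ is symmetric difference. A (left) Følner net in $T$ is a net $\{F_n\mid n\in D\}$ in $\mathscr{K}_T$ with $\lim_n |tF_n\vartriangle F_n|/|F_n|=0$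 for all $t\in T$; $\mathscr{F}[T]$ is the collection of all Følner nets in $T$. $\mathscr{U}_X$ is the unique compatible symmetric uniform structure on $X$; for $\varepsilon\in\mathscr{U}_X$, $\varepsilon[x]=\{y\in X : (x,y)\in\varepsilon\}$, an open neighborhood of $x$ (entourages are taken symmetric and open). $N_T(x,U)=\{t\in T : tx\in U\}$, and $$\mathrm{BD}_*(T,x,\varepsilon)=\inf_{\{F_n\mid n\in D\}\in\mathscr{F}[T]}\ \liminf_{n\in D}\frac{|F_n\cap N_T(x,\varepsilon[x])|}{|F_n|}.$$ *)

theory Defs
  imports "HOL-Analysis.Analysis" "HOL-Algebra.Group_Action"
begin

section \<open>Flows with discrete phase group\<close>

text \<open>The discrete phase group is a group in the sense of HOL-Algebra; the phase space is a
  whole type \<open>'x\<close>. The empty space is thereby excluded.\<close>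

locale flow = group_action T UNIV \<phi>
  for T :: "('g, 'b) monoid_scheme" (structure)
    and \<phi> :: "'g \<Rightarrow> 'x :: topological_space \<Rightarrow> 'x" +
  assumes jointly_continuous:
    "continuous_map (prod_topology (discrete_topology (carrier T)) euclidean) euclidean
       (\<lambda>(t, x). \<phi> t x)"

lemma flow_iff:
  fixes T :: "('g, 'b) monoid_scheme" (structure)
    and \<phi> :: "'g \<Rightarrow> 'x :: topological_space \<Rightarrow> 'x"
  shows "flow T \<phi> \<longleftrightarrow>
    group T \<and> (\<forall>x. \<phi> \<one> x = x) \<and>
    (\<forall>t\<in>carrier T. \<forall>s\<in>carrier T. \<forall>x. \<phi> t (\<phi> s x) = \<phi> (t \<otimes> s) x) \<and>
    continuous_map (prod_topology (discrete_topology (carrier T)) euclidean) euclidean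
      (\<lambda>(t, x). \<phi> t x)"
    (is "?L \<longleftrightarrow> ?R")
proof
  assume ?L
  then interpret flow T \<phi> .
  have "group T" using group_hom group_hom.axioms(1) by blast
  moreover have "\<phi> \<one> x = x" for x
    using id_eq_one by (metis UNIV_I restrict_apply')
  moreover have "\<phi> t (\<phi> s x) = \<phi> (t \<otimes> s) x" if "t \<in> carrier T" "s \<in> carrier T" for t s x
    using composition_rule[of x t s] that by simp
  ultimately show ?R using jointly_continuous by blast
next
  assume R: ?R
  then interpret group T by blast
  have bij: "\<phi> t \<in> Bij UNIV" if t: "t \<in> carrier T" for t
  proof -
    have "\<phi> t \<circ> \<phi> (inv t) = id" "\<phi> (inv t) \<circ> \<phi> t = id"
      using R t by (auto simp: fun_eq_iff)
    then have "bij (\<phi> t)" using o_bij by blast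
    then show ?thesis by (simp add: Bij_def)
  qed
  have "\<phi> \<in> hom T (BijGroup UNIV)"
    using R bij by (auto simp: hom_def BijGroup_def compose_def fun_eq_iff)
  then have "group_action T UNIV \<phi>"
    by (simp add: group_action_def group_hom_def group_hom_axioms_def group_BijGroup is_group)
  then show ?L using R by (simp add: flow_def flow_axioms_def)
qed

text \<open>The collection \<open>\<K>\<^sub>T\<close>: for discrete \<open>T\<close>, compact means finite.\<close>

definition compact_sets :: "('g, 'b) monoid_scheme \<Rightarrow> 'g set set" where
  "compact_sets T = {K. K \<subseteq> carrier T \<and> K \<noteq> {} \<and> finite K}"

definition syndetic :: "('g, 'b) monoid_scheme \<Rightarrow> 'g set \<Rightarrow> bool" where
  "syndetic T A \<longleftrightarrow> A \<subseteq> carrier T \<and>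
     (\<exists>K\<in>compact_sets T. \<forall>t\<in>carrier T. (K #>\<^bsub>T\<^esub> t) \<inter> A \<noteq> {})"

definition neighborhoods :: "'x :: topological_space \<Rightarrow> 'x set set" where
  "neighborhoods x = {U. eventually (\<lambda>y. y \<in> U) (nhds x)}"

definition wlap_point ::
    "('g, 'b) monoid_scheme \<Rightarrow> ('g \<Rightarrow> 'x \<Rightarrow> 'x) \<Rightarrow> 'x :: topological_space \<Rightarrow> bool" where
  "wlap_point T \<phi> x \<longleftrightarrow>
     (\<forall>U\<in>neighborhoods x. \<exists>V\<in>neighborhoods x. \<exists>A. syndetic T A \<and>
       (\<exists>K\<in>compact_sets T. \<forall>x'\<in>V. \<exists>B\<subseteq>carrier T.
          (\<forall>t\<in>A. (K #>\<^bsub>T\<^esub> t) \<inter> B \<noteq> {}) \<and> (\<forall>b\<in>B. \<phi> b x' \<in> U)))"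

definition wlap_flow ::
    "('g, 'b) monoid_scheme \<Rightarrow> ('g \<Rightarrow> 'x \<Rightarrow> 'x :: topological_space) \<Rightarrow> bool" where
  "wlap_flow T \<phi> \<longleftrightarrow> flow T \<phi> \<and> (\<forall>x. wlap_point T \<phi> x)"

section \<open>Amenability and Folner nets\<close>

locale amenable_group = group T for T :: "('g, 'b) monoid_scheme" (structure) +
  assumes left_folner_condition:
    "\<lbrakk>K \<in> compact_sets T; \<epsilon> > (0 :: real)\<rbrakk> \<Longrightarrow>
       \<exists>F\<in>compact_sets T. real (card (sym_diff (K <#> F) F)) < \<epsilon> * real (card F)"

definition directed_set :: "'d set \<Rightarrow> 'd rel \<Rightarrow> bool" where
  "directed_set D r \<longleftrightarrow> D \<noteq> {} \<and> preorder_on D r \<and>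
     (\<forall>a\<in>D. \<forall>b\<in>D. \<exists>c\<in>D. (a, c) \<in> r \<and> (b, c) \<in> r)"

text \<open>The filter of tails of the directed set \<open>D\<close>; \<open>(m, n) \<in> r\<close> reads \<open>m \<le> n\<close>. Limits and
  lower limits of nets are the library's limits and \<^const>\<open>Liminf\<close> along this filter.\<close>

definition tails :: "'d set \<Rightarrow> 'd rel \<Rightarrow> 'd filter" where
  "tails D r = (INF m\<in>D. principal {n. (m, n) \<in> r})"

lemma eventually_tails:
  assumes "directed_set D r"
  shows "eventually P (tails D r) \<longleftrightarrow> (\<exists>m\<in>D. \<forall>n\<in>D. (m, n) \<in> r \<longrightarrow> P n)"
proof -
  have r: "r \<subseteq> D \<times> D" "trans r" "D \<noteq> {}" and
    ub: "\<And>a b. a \<in> D \<Longrightarrow> b \<in> D \<Longrightarrow> \<exists>c\<in>D. (a, c) \<in> r \<and> (b, c) \<in> r"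
    using assms by (auto simp: directed_set_def preorder_on_def refl_on_def)
  have "eventually P (tails D r) \<longleftrightarrow> (\<exists>m\<in>D. eventually P (principal {n. (m, n) \<in> r}))"
    unfolding tails_def
  proof (rule eventually_INF_base)
    fix a b assume "a \<in> D" "b \<in> D"
    then obtain c where "c \<in> D" "(a, c) \<in> r" "(b, c) \<in> r" using ub by blast
    then show "\<exists>x\<in>D. principal {n. (x, n) \<in> r} \<le>
        inf (principal {n. (a, n) \<in> r}) (principal {n. (b, n) \<in> r})"
      using r(2) by (intro bexI[of _ c]) (auto dest: transD)
  qed (use r in auto)
  then show ?thesis using r(1) by (auto simp: eventually_principal)
qed

text \<open>A net is a triple of index set, order and family; \<open>'d\<close> is the type of its indices.\<close>

definition folner_nets ::
    "('g, 'b) monoid_scheme \<Rightarrow> ('d set \<times> 'd rel \<times> ('d \<Rightarrow> 'g set)) set" where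
  "folner_nets T = {(D, r, F). directed_set D r \<and> (\<forall>n\<in>D. F n \<in> compact_sets T) \<and>
     (\<forall>t\<in>carrier T.
       ((\<lambda>n. real (card (sym_diff (t <#\<^bsub>T\<^esub> F n) (F n))) / real (card (F n))) \<longlongrightarrow> 0) (tails D r))}"

section \<open>Entourages and lower Banach density of return times\<close>

text \<open>Entourages are taken symmetric and open. A uniform structure on \<open>'x\<close> given by the class
  \<^class>\<open>uniform_space\<close> is compatible with the topology, hence unique if \<open>'x\<close> is compact Hausdorff.\<close>

definition entourages :: "('x :: uniform_space \<times> 'x) set set" where
  "entourages = {\<epsilon>. eventually (\<lambda>p. p \<in> \<epsilon>) uniformity \<and> sym \<epsilon> \<and> open \<epsilon>}"

definition return_times ::
    "('g, 'b) monoid_scheme \<Rightarrow> ('g \<Rightarrow> 'x \<Rightarrow> 'x) \<Rightarrow> 'x \<Rightarrow> 'x set \<Rightarrow> 'g set" where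
  "return_times T \<phi> x U = {t \<in> carrier T. \<phi> t x \<in> U}"

text \<open>The infimum ranges over the Folner nets indexed by subsets of the type \<open>'d\<close>, since HOL cannot
  quantify over all types at once; \<open>BD_lower_le\<close> below shows that it is smallest possible already
  for \<open>'d = 'g set \<times> nat\<close>. It is taken in the extended reals, so that it is the top element if there
  is no Folner net with indices in \<open>'d\<close>.\<close>

definition BD_lower ::
    "'d itself \<Rightarrow> ('g, 'b) monoid_scheme \<Rightarrow> ('g \<Rightarrow> 'x \<Rightarrow> 'x) \<Rightarrow> 'x \<Rightarrow> ('x \<times> 'x) set \<Rightarrow> ereal" where
  "BD_lower _ T \<phi> x \<epsilon> =
     (INF (D, r, F) \<in> (folner_nets T :: ('d set \<times> 'd rel \<times> ('d \<Rightarrow> 'g set)) set).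
        Liminf (tails D r)
          (\<lambda>n. ereal (real (card (F n \<inter> return_times T \<phi> x (\<epsilon> `` {x}))) / real (card (F n)))))"

lemma BD_lower_le:
  fixes T :: "('g, 'b) monoid_scheme"
  shows "BD_lower TYPE('g set \<times> nat) T \<phi> x \<epsilon> \<le> BD_lower TYPE('d) T \<phi> x \<epsilon>"
proof -
  define N where "N = return_times T \<phi> x (\<epsilon> `` {x})"
  define q where "q S = ereal (real (card (S \<inter> N)) / real (card S))" for S :: "'g set"
  define d where "d t S = real (card (sym_diff (t <#\<^bsub>T\<^esub> S) S)) / real (card S)" for t S
  have *: "BD_lower TYPE('g set \<times> nat) T \<phi> x \<epsilon> \<le> c"
    if net: "(D, r, F) \<in> folner_nets T" and c: "Liminf (tails D r) (\<lambda>n. q (F n)) < c"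
    for D :: "'d set" and r F c
  proof -
    have dir: "directed_set D r" and cs: "\<And>n. n \<in> D \<Longrightarrow> F n \<in> compact_sets T"
      and lim: "\<And>t. t \<in> carrier T \<Longrightarrow> ((\<lambda>n. d t (F n)) \<longlongrightarrow> 0) (tails D r)"
      using net by (auto simp: folner_nets_def d_def)
    have freq: "\<exists>n\<in>D. P n \<and> q (F n) < c" if P: "eventually P (tails D r)" for P
    proof (rule ccontr)
      assume contra: "\<not> ?thesis"
      have "eventually (\<lambda>n. n \<in> D) (tails D r)"
        using dir by (auto simp: eventually_tails directed_set_def)
      with P have "eventually (\<lambda>n. c \<le> q (F n)) (tails D r)"
        by eventually_elim (use contra in \<open>auto simp: not_less\<close>)
      then have "c \<le> Liminf (tails D r) (\<lambda>n. q (F n))" by (rule Liminf_bounded)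
      with c show False by simp
    qed
    define E where "E = {K. K \<subseteq> carrier T \<and> finite K} \<times> (UNIV :: nat set)"
    define s where "s = {(a, b). a \<in> E \<and> b \<in> E \<and> fst a \<subseteq> fst b \<and> snd a \<le> snd b}"
    have "\<exists>n\<in>D. (\<forall>t\<in>fst a. d t (F n) < 1 / Suc (snd a)) \<and> q (F n) < c" if "a \<in> E" for a
    proof (rule freq)
      have "eventually (\<lambda>n. d t (F n) < 1 / Suc (snd a)) (tails D r)" if "t \<in> fst a" for t
        using lim[of t] that \<open>a \<in> E\<close> by (intro order_tendstoD(2)) (auto simp: E_def)
      then show "eventually (\<lambda>n. \<forall>t\<in>fst a. d t (F n) < 1 / Suc (snd a)) (tails D r)"
        using \<open>a \<in> E\<close> by (intro eventually_ball_finite) (auto simp: E_def)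
    qed
    then obtain g where g: "\<And>a. a \<in> E \<Longrightarrow> g a \<in> D"
      "\<And>a t. a \<in> E \<Longrightarrow> t \<in> fst a \<Longrightarrow> d t (F (g a)) < 1 / Suc (snd a)"
      "\<And>a. a \<in> E \<Longrightarrow> q (F (g a)) < c"
      by metis
    have dirE: "directed_set E s"
      unfolding directed_set_def
    proof (intro conjI ballI)
      show "E \<noteq> {}" by (auto simp: E_def)
      show "preorder_on E s"
        by (auto simp: preorder_on_def refl_on_def trans_def s_def)
      fix a b assume "a \<in> E" "b \<in> E"
      then show "\<exists>c\<in>E. (a, c) \<in> s \<and> (b, c) \<in> s"
        by (intro bexI[of _ "(fst a \<union> fst b, max (snd a) (snd b))"]) (auto simp: s_def E_def)
    qed
    have "((\<lambda>a. d t (F (g a))) \<longlongrightarrow> 0) (tails E s)" if t: "t \<in> carrier T" for t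
    proof (rule tendstoI)
      fix e :: real assume "e > 0"
      then obtain k where k: "1 / Suc k < e" by (metis inverse_eq_divide reals_Archimedean)
      have "dist (d t (F (g a))) 0 < e" if "a \<in> E" "(({t}, k), a) \<in> s" for a
      proof -
        have "d t (F (g a)) < 1 / Suc (snd a)" using that by (intro g(2)) (auto simp: s_def)
        also have "\<dots> \<le> 1 / Suc k" using that by (auto simp: s_def intro!: divide_left_mono)
        finally show ?thesis using k by (simp add: d_def)
      qed
      moreover have "({t}, k) \<in> E" using t by (simp add: E_def)
      ultimately show "eventually (\<lambda>a. dist (d t (F (g a))) 0 < e) (tails E s)"
        using eventually_tails[OF dirE] by blast
    qed
    then have "(E, s, F \<circ> g) \<in> folner_nets T"
      using dirE cs g(1) by (auto simp: folner_nets_def d_def)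
    then have "BD_lower TYPE('g set \<times> nat) T \<phi> x \<epsilon> \<le> Liminf (tails E s) (\<lambda>a. q ((F \<circ> g) a))"
      unfolding BD_lower_def q_def N_def by (rule INF_lower2) simp
    also have "\<dots> \<le> Limsup (tails E s) (\<lambda>a. q ((F \<circ> g) a))"
    proof (rule Liminf_le_Limsup)
      show "tails E s \<noteq> bot"
        using dirE unfolding trivial_limit_def eventually_tails[OF dirE]
        by (auto simp: directed_set_def preorder_on_def refl_on_def)
    qed
    also have "\<dots> \<le> c"
    proof (rule Limsup_bounded)
      have "q (F (g a)) \<le> c" if "a \<in> E" for a using g(3)[OF that] by simp
      then show "eventually (\<lambda>a. q ((F \<circ> g) a) \<le> c) (tails E s)"
        using dirE by (auto simp: eventually_tails directed_set_def)
    qed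
    finally show ?thesis .
  qed
  show ?thesis
    unfolding BD_lower_def[of "TYPE('d)"]
  proof (rule INF_greatest, clarify)
    fix D :: "'d set" and r F assume net: "(D, r, F) \<in> folner_nets T"
    have "BD_lower TYPE('g set \<times> nat) T \<phi> x \<epsilon> \<le> Liminf (tails D r) (\<lambda>n. q (F n))"
      by (rule dense_ge) (rule *[OF net])
    then show "BD_lower TYPE('g set \<times> nat) T \<phi> x \<epsilon> \<le> Liminf (tails D r)
        (\<lambda>n. ereal (real (card (F n \<inter> return_times T \<phi> x (\<epsilon> `` {x}))) / real (card (F n))))"
      by (simp add: q_def N_def)
  qed
qed

end

theory Submission
  imports Defs
begin

text \<open>Two facts combine.

  A set \<open>A\<close> that meets \<open>K t\<close> for every \<open>t\<close>, with \<open>K\<close> finite, satisfies \<open>T = \<Union>k\<in>K. k\<^sup>-\<^sup>1 A\<close>. A Folner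
  set \<open>F\<close> is nearly invariant under each \<open>k \<in> K\<close>, so each of these \<open>card K\<close> translates of \<open>A\<close> fills
  nearly the same fraction of \<open>F\<close> as \<open>A\<close> does; since together they cover \<open>F\<close>, that fraction is at
  least about \<open>1 / card K\<close>. So the lower density of \<open>A\<close> is bounded below by a number that depends on
  \<open>card K\<close> only (\<open>folner_net_density_ge\<close>).

  It remains to find, for a given entourage, one finite set \<open>K\<close> that witnesses the syndeticity of
  the return times of all points at once (\<open>wlap_flow_uniformly_syndetic_return_times\<close>). Weak local
  almost periodicity at \<open>x\<close> yields such a set for all points of a neighborhood of \<open>x\<close>, because points
  near \<open>x\<close> that return near \<open>x\<close> also return near themselves. By compactness finitely many of these
  neighborhoods cover the space, and the union of their witnesses serves every point.\<close>

text \<open>The translates \<open>k\<^sup>-\<^sup>1 A\<close> cover \<open>F\<close>, and left translation by \<open>k\<close> moves \<open>F \<inter> k\<^sup>-\<^sup>1 A\<close> injectively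
  into \<open>A\<close>, where it can leave \<open>F\<close> only through \<open>k F - F\<close>.\<close>

lemma (in group) card_le_of_hits_translates:
  assumes K: "K \<in> compact_sets G" and F: "F \<in> compact_sets G"
    and hits: "\<And>t. t \<in> carrier G \<Longrightarrow> (K #> t) \<inter> A \<noteq> {}"
  shows "card F \<le> card K * card (F \<inter> A) + (\<Sum>k\<in>K. card (sym_diff (k <# F) F))"
proof -
  have Kc: "K \<subseteq> carrier G" "finite K" and Fc: "F \<subseteq> carrier G" "finite F"
    using K F by (auto simp: compact_sets_def)
  define P where "P k = {f \<in> F. k \<otimes> f \<in> A}" for k
  have "F \<subseteq> (\<Union>k\<in>K. P k)"
  proof
    fix f assume f: "f \<in> F"
    then have "(K #> f) \<inter> A \<noteq> {}" using hits Fc(1) by blast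
    then show "f \<in> (\<Union>k\<in>K. P k)" using f by (auto simp: r_coset_def P_def)
  qed
  then have "card F \<le> card (\<Union>k\<in>K. P k)"
    by (intro card_mono) (use Kc Fc in \<open>auto simp: P_def\<close>)
  also have "\<dots> \<le> (\<Sum>k\<in>K. card (P k))"
    using Kc by (intro card_UN_le)
  also have "\<dots> \<le> (\<Sum>k\<in>K. card (F \<inter> A) + card (sym_diff (k <# F) F))"
  proof (rule sum_mono)
    fix k assume k: "k \<in> K"
    have fin: "finite (k <# F)" using Fc by (auto simp: l_coset_def)
    have "inj_on ((\<otimes>) k) (P k)"
      using k Kc Fc by (intro inj_onI) (auto simp: P_def subset_iff)
    then have "card (P k) = card ((\<otimes>) k ` P k)" by (simp add: card_image)
    also have "\<dots> \<le> card ((F \<inter> A) \<union> sym_diff (k <# F) F)"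
      using fin Fc by (intro card_mono) (auto simp: P_def l_coset_def)
    also have "\<dots> \<le> card (F \<inter> A) + card (sym_diff (k <# F) F)" by (rule card_Un_le)
    finally show "card (P k) \<le> card (F \<inter> A) + card (sym_diff (k <# F) F)" .
  qed
  also have "\<dots> = card K * card (F \<inter> A) + (\<Sum>k\<in>K. card (sym_diff (k <# F) F))"
    by (simp add: sum.distrib)
  finally show ?thesis .
qed

lemma tails_neq_bot:
  assumes "directed_set D r"
  shows "tails D r \<noteq> bot"
  using assms unfolding trivial_limit_def eventually_tails[OF assms]
  by (auto simp: directed_set_def preorder_on_def refl_on_def)

lemma (in group) folner_net_density_ge:
  assumes net: "(D, r, F) \<in> folner_nets G" and K: "K \<in> compact_sets G"
    and hits: "\<And>t. t \<in> carrier G \<Longrightarrow> (K #> t) \<inter> A \<noteq> {}"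
  shows "ereal (1 / card K) \<le>
    Liminf (tails D r) (\<lambda>n. ereal (real (card (F n \<inter> A)) / real (card (F n))))"
proof -
  define d where "d k n = real (card (sym_diff (k <# F n) (F n))) / real (card (F n))" for k n
  have dir: "directed_set D r" and cs: "\<And>n. n \<in> D \<Longrightarrow> F n \<in> compact_sets G"
    and lim: "\<And>t. t \<in> carrier G \<Longrightarrow> (d t \<longlongrightarrow> 0) (tails D r)"
    using net by (auto simp: folner_nets_def d_def[abs_def])
  have Kc: "K \<subseteq> carrier G" "card K > 0"
    using K by (auto simp: compact_sets_def card_gt_0_iff)
  have bound: "(1 - (\<Sum>k\<in>K. d k n)) / card K \<le> real (card (F n \<inter> A)) / real (card (F n))"
    if n: "n \<in> D" for n
  proof -
    have pos: "real (card (F n)) > 0"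
      using cs[OF n] by (auto simp: compact_sets_def card_gt_0_iff)
    have "real (card (F n)) \<le>
        real (card K * card (F n \<inter> A) + (\<Sum>k\<in>K. card (sym_diff (k <# F n) (F n))))"
      by (rule of_nat_mono) (rule card_le_of_hits_translates[OF K cs[OF n] hits])
    also have "\<dots> = card K * real (card (F n \<inter> A)) + (\<Sum>k\<in>K. d k n) * card (F n)"
      using pos by (simp add: d_def sum_distrib_right)
    finally show ?thesis using pos Kc(2) by (simp add: field_simps)
  qed
  have "((\<lambda>n. (1 - (\<Sum>k\<in>K. d k n)) / card K) \<longlongrightarrow> (1 - (\<Sum>k\<in>K. 0)) / card K) (tails D r)"
    using Kc lim by (intro tendsto_intros) auto
  then have "((\<lambda>n. ereal ((1 - (\<Sum>k\<in>K. d k n)) / card K)) \<longlongrightarrow> ereal (1 / card K)) (tails D r)"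
    by (simp add: tendsto_ereal)
  then have "ereal (1 / card K) = Liminf (tails D r) (\<lambda>n. ereal ((1 - (\<Sum>k\<in>K. d k n)) / card K))"
    by (rule lim_imp_Liminf[OF tails_neq_bot[OF dir], symmetric])
  also have "\<dots> \<le> Liminf (tails D r) (\<lambda>n. ereal (real (card (F n \<inter> A)) / real (card (F n))))"
  proof (rule Liminf_mono)
    have "eventually (\<lambda>n. n \<in> D) (tails D r)"
      using dir by (auto simp: eventually_tails directed_set_def)
    then show "eventually (\<lambda>n. ereal ((1 - (\<Sum>k\<in>K. d k n)) / card K)
        \<le> ereal (real (card (F n \<inter> A)) / real (card (F n)))) (tails D r)"
      by eventually_elim (simp add: bound)
  qed
  finally show ?thesis .
qed

text \<open>If \<open>A\<close> meets all translates \<open>K' t\<close> and \<open>B\<close> meets \<open>K a\<close> for all \<open>a \<in> A\<close>, then \<open>B\<close> meets all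
  translates \<open>K K' t\<close>. Hence \<open>K K'\<close> is a witness of syndeticity for every set \<open>B\<close> in the definition of
  a w.l.a.p. point, while \<open>B\<close> itself varies with \<open>x'\<close>.\<close>

lemma (in group) set_mult_hits_translates:
  assumes "K \<subseteq> carrier G" "K' \<subseteq> carrier G" "t \<in> carrier G"
    and "(K' #> t) \<inter> A \<noteq> {}" and "\<And>a. a \<in> A \<Longrightarrow> (K #> a) \<inter> B \<noteq> {}"
  shows "((K <#> K') #> t) \<inter> B \<noteq> {}"
proof -
  obtain k' where k': "k' \<in> K'" "k' \<otimes> t \<in> A"
    using assms(4) by (auto simp: r_coset_def)
  obtain k where k: "k \<in> K" "k \<otimes> (k' \<otimes> t) \<in> B"
    using assms(5)[OF k'(2)] by (auto simp: r_coset_def)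
  have "k \<otimes> (k' \<otimes> t) = (k \<otimes> k') \<otimes> t"
    using k k' assms(1-3) by (simp add: m_assoc subset_iff)
  with k k' show ?thesis by (force simp: r_coset_def set_mult_def)
qed

lemma wlap_point_locally_uniformly_syndetic_return_times:
  fixes x :: "'x :: uniform_space"
  assumes "group T" and x: "wlap_point T \<phi> x" and \<epsilon>: "eventually (\<lambda>p. p \<in> \<epsilon>) uniformity"
  obtains V K where "open V" "x \<in> V" "K \<in> compact_sets T"
    "\<And>y t. y \<in> V \<Longrightarrow> t \<in> carrier T \<Longrightarrow>
       (K #>\<^bsub>T\<^esub> t) \<inter> return_times T \<phi> y (\<epsilon> `` {y}) \<noteq> {}"
proof -
  interpret group T by fact
  obtain D where D: "eventually D uniformity" "\<And>a b. D (a, b) \<Longrightarrow> D (b, a)"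
    "\<And>a b c. D (a, b) \<Longrightarrow> D (b, c) \<Longrightarrow> (a, c) \<in> \<epsilon>"
  proof -
    obtain D where D: "eventually D uniformity"
      "\<And>a b c. D (a, b) \<Longrightarrow> D (b, c) \<Longrightarrow> (a, c) \<in> \<epsilon>"
      using uniformity_transE[OF \<epsilon>] by blast
    have "eventually (\<lambda>p. D p \<and> D (snd p, fst p)) uniformity"
      using D(1) uniformity_sym[OF D(1)] by eventually_elim auto
    then show ?thesis
      by (rule that[of "\<lambda>p. D p \<and> D (snd p, fst p)"]) (auto intro: D(2))
  qed
  define U where "U = {y. D (x, y)}"
  have U: "U \<in> neighborhoods x"
    unfolding neighborhoods_def U_def eventually_nhds_uniformity mem_Collect_eq
    using D(1) by (rule eventually_mono) auto
  obtain V A K where V: "V \<in> neighborhoods x" and A: "syndetic T A" and K: "K \<in> compact_sets T"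
    and B: "\<forall>y\<in>V. \<exists>B\<subseteq>carrier T. (\<forall>t\<in>A. (K #>\<^bsub>T\<^esub> t) \<inter> B \<noteq> {}) \<and> (\<forall>b\<in>B. \<phi> b y \<in> U)"
    using bspec[OF x[unfolded wlap_point_def] U] by blast
  obtain K' where K': "K' \<in> compact_sets T"
    and hits: "\<And>t. t \<in> carrier T \<Longrightarrow> (K' #>\<^bsub>T\<^esub> t) \<inter> A \<noteq> {}"
    using A by (auto simp: syndetic_def)
  \<comment> \<open>The neighborhood \<open>V\<close> controls visits to \<open>U\<close> only; a visit of \<open>y\<close> to \<open>U\<close> is a return of \<open>y\<close> to
    itself once \<open>y\<close> lies in \<open>U\<close>, too.\<close>
  have "eventually (\<lambda>y. y \<in> U \<inter> V) (nhds x)"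
    using U V by (auto simp: neighborhoods_def eventually_conj)
  then obtain W where W: "open W" "x \<in> W" "W \<subseteq> U \<inter> V"
    unfolding eventually_nhds by (metis subsetI)
  show ?thesis
  proof (rule that[of W "K <#>\<^bsub>T\<^esub> K'"])
    show "K <#>\<^bsub>T\<^esub> K' \<in> compact_sets T"
      using K K' by (auto simp: compact_sets_def set_mult_def)
    fix y t assume y: "y \<in> W" and t: "t \<in> carrier T"
    obtain B where B: "B \<subseteq> carrier T" "\<And>a. a \<in> A \<Longrightarrow> (K #>\<^bsub>T\<^esub> a) \<inter> B \<noteq> {}"
      "\<And>b. b \<in> B \<Longrightarrow> \<phi> b y \<in> U"
      using bspec[OF B, of y] y W(3) by blast
    \<comment> \<open>\<open>y\<close> and \<open>b y\<close> are both \<open>D\<close>-close to \<open>x\<close>, hence \<open>\<epsilon>\<close>-close to each other.\<close>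
    have "B \<subseteq> return_times T \<phi> y (\<epsilon> `` {y})"
    proof
      fix b assume b: "b \<in> B"
      have "D (y, x)" using y W(3) D(2) by (auto simp: U_def)
      moreover have "D (x, \<phi> b y)" using B(3)[OF b] by (simp add: U_def)
      ultimately show "b \<in> return_times T \<phi> y (\<epsilon> `` {y})"
        using b B(1) D(3) by (auto simp: return_times_def)
    qed
    moreover have "((K <#>\<^bsub>T\<^esub> K') #>\<^bsub>T\<^esub> t) \<inter> B \<noteq> {}"
      using K K' by (intro set_mult_hits_translates[OF _ _ t hits[OF t] B(2)])
        (auto simp: compact_sets_def)
    ultimately show "((K <#>\<^bsub>T\<^esub> K') #>\<^bsub>T\<^esub> t) \<inter> return_times T \<phi> y (\<epsilon> `` {y}) \<noteq> {}"
      by blast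
  qed (use W in auto)
qed

lemma wlap_flow_uniformly_syndetic_return_times:
  fixes \<phi> :: "'g \<Rightarrow> 'x :: uniform_space \<Rightarrow> 'x"
  assumes comp: "compact (UNIV :: 'x set)" and wlap: "wlap_flow T \<phi>"
    and \<epsilon>: "eventually (\<lambda>p. p \<in> \<epsilon>) uniformity"
  obtains K where "K \<in> compact_sets T"
    "\<And>x t. t \<in> carrier T \<Longrightarrow> (K #>\<^bsub>T\<^esub> t) \<inter> return_times T \<phi> x (\<epsilon> `` {x}) \<noteq> {}"
proof -
  have "group T" using wlap by (simp add: wlap_flow_def flow_iff)
  have "\<exists>V K. open V \<and> x \<in> V \<and> K \<in> compact_sets T \<and>
      (\<forall>y\<in>V. \<forall>t\<in>carrier T. (K #>\<^bsub>T\<^esub> t) \<inter> return_times T \<phi> y (\<epsilon> `` {y}) \<noteq> {})" for x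
  proof -
    have "wlap_point T \<phi> x" using wlap by (simp add: wlap_flow_def)
    then show ?thesis
      by (rule wlap_point_locally_uniformly_syndetic_return_times[OF \<open>group T\<close> _ \<epsilon>]) blast
  qed
  then obtain V K where V: "\<And>x. open (V x)" "\<And>x. x \<in> V x" and K: "\<And>x. K x \<in> compact_sets T"
    and hits: "\<And>x y t. y \<in> V x \<Longrightarrow> t \<in> carrier T \<Longrightarrow>
      (K x #>\<^bsub>T\<^esub> t) \<inter> return_times T \<phi> y (\<epsilon> `` {y}) \<noteq> {}"
    by metis
  obtain C where C: "finite C" "UNIV \<subseteq> (\<Union>x\<in>C. V x)"
    using compactE_image[OF comp, of UNIV V] V by (metis UNIV_I UN_I subsetI)
  show ?thesis
  proof (rule that[of "\<Union>x\<in>C. K x"])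
    have "C \<noteq> {}" using C(2) by auto
    then show "(\<Union>x\<in>C. K x) \<in> compact_sets T"
      using C(1) K by (fastforce simp: compact_sets_def)
    fix y t assume t: "t \<in> carrier T"
    obtain x where x: "x \<in> C" "y \<in> V x" using C(2) by blast
    then have "K x #>\<^bsub>T\<^esub> t \<subseteq> (\<Union>x\<in>C. K x) #>\<^bsub>T\<^esub> t" by (auto simp: r_coset_def)
    with hits[OF x(2) t]
    show "((\<Union>x\<in>C. K x) #>\<^bsub>T\<^esub> t) \<inter> return_times T \<phi> y (\<epsilon> `` {y}) \<noteq> {}" by blast
  qed
qed

theorem theorem4p4:
  fixes T :: "('g, 'b) monoid_scheme"
    and \<phi> :: "'g \<Rightarrow> 'x :: {uniform_space, t2_space} \<Rightarrow> 'x"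
  assumes "compact (UNIV :: 'x set)"
    and "amenable_group T"
    and "wlap_flow T \<phi>"
  shows "\<forall>\<epsilon>\<in>entourages. (INF x. BD_lower TYPE('d) T \<phi> x \<epsilon>) > 0"
proof
  fix \<epsilon> :: "('x \<times> 'x) set" assume "\<epsilon> \<in> entourages"
  then have "eventually (\<lambda>p. p \<in> \<epsilon>) uniformity" by (simp add: entourages_def)
  then obtain K where K: "K \<in> compact_sets T"
    and hits: "\<And>x t. t \<in> carrier T \<Longrightarrow> (K #>\<^bsub>T\<^esub> t) \<inter> return_times T \<phi> x (\<epsilon> `` {x}) \<noteq> {}"
    by (rule wlap_flow_uniformly_syndetic_return_times[OF assms(1,3)]) blast
  interpret amenable_group T by fact
  have "0 < ereal (1 / card K)"
    using K by (auto simp: compact_sets_def card_gt_0_iff)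
  also have "\<dots> \<le> (INF x. BD_lower TYPE('d) T \<phi> x \<epsilon>)"
  proof (rule INF_greatest)
    fix x
    show "ereal (1 / card K) \<le> BD_lower TYPE('d) T \<phi> x \<epsilon>"
      unfolding BD_lower_def
      by (rule INF_greatest, clarify) (rule folner_net_density_ge[OF _ K hits])
  qed
  finally show "(INF x. BD_lower TYPE('d) T \<phi> x \<epsilon>) > 0" .
qed

end
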